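(* Let $T:V\to\mathfrak g$ be an embedding tensor on a $3$-Lie algebra $(\mathfrak g,[\cdot,\cdot,\cdot]_{\mathfrak g})$ with respect to a representation $(V;\rho)$. Then for a linear map $T':V\to\mathfrak g$, $T+T'$ is an embedding tensor (on $\mathfrak g$ with respect to $(V;\rho)$) if and only if $T'$ is a Maurer-Cartan element of the twisted $L_\infty$-algebra $(C^*(V,\mathfrak g),l_1^T,l_2^T,l_3^T)$, that is, $T'$ satisfies the Maurer-Cartan equation $$l_1^T(T')+\frac12l_2^T(T',T')+\frac1{3!}l_3^T(T',T',T')=0.$$
   Context: All vector spaces are over an algebraically closed field $\mathbb K$ of characteristic $0$. A $3$-Lie algebra is a vector space $\mathfrak g$ with a skew-symmetric trilinear bracket $[\cdot,\cdot,\cdot]_{\mathfrak g}$ such that $[x_1,x_2,[x_3,x_4,x_5]_{\mathfrak g}]_{\mathfrak g}=[[x_1,x_2,x_3]_{\mathfrak g},x_4,x_5]_{\mathfrak g}+[x_3,[x_1,x_2,x_4]_{\mathfrak g},x_5]_{\mathfrak g}+[x_3,x_4,[x_1,x_2,x_5]_{\mathfrak g}]_{\mathfrak g}$ for all $x_i\in\mathfrak g$. A representation of $\mathfrak g$ on a vector space $V$ is a linear map $\rho:\wedge^2\mathfrak g\to\mathfrak{gl}(V)$ such that for all $x_i\in\mathfrak g$: $\rho(x_1,x_2)\rho(x_3,x_4)=\rho([x_1,x_2,x_3]_{\mathfrak g},x_4)+\rho(x_3,[x_1,x_2,x_4]_{\mathfrak g})+\rho(x_3,x_4)\rho(x_1,x_2)$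 and $\rho(x_1,[x_2,x_3,x_4]_{\mathfrak g})=\rho(x_3,x_4)\rho(x_1,x_2)-\rho(x_2,x_4)\rho(x_1,x_3)+\rho(x_2,x_3)\rho(x_1,x_4)$. An embedding tensor on $\mathfrak g$ with respect to $(V;\rho)$ is a linear map $T:V\to\mathfrak g$ with $[Tu,Tv,Tw]_{\mathfrak g}=T(\rho(Tu,Tv)w)$ for all $u,v,w\in V$. Graded Lie algebra $C^*(W,W)$. For a vector space $W$, $C^n(W,W)=\mathrm{Hom}((\otimes^2W)^{\otimes n}\otimes W,W)$ has degree $n\ge0$ and $C^*(W,W)=\bigoplus_{n\ge0}C^n(W,W)$. For $P\in C^p(W,W)$, $Q\in C^q(W,W)$, $[P,Q]_{\mathsf{3Leib}}=P\circ Q-(-1)^{pq}Q\circ P$, where for $\mathfrak X_i=x_i\otimes y_i\in\otimes^2W$ and $x\in W$, $(P\circ Q)(\mathfrak X_1,\dots,\mathfrak X_{p+q},x)$ $=\sum_{k=1}^p(-1)^{(k-1)q}\sum_{\sigma\in S(k-1,q)}(-1)^\sigma P\big(\mathfrak X_{\sigma(1)},\dots,\mathfrak X_{\sigma(k-1)},Q(\mathfrak X_{\sigma(k)},\dots,\mathfrak X_{\sigma(k+q-1)},x_{k+q})\otimes y_{k+q},\mathfrak X_{k+q+1},\dots,\mathfrak X_{p+q},x\big)$ $+\sum_{k=1}^p(-1)^{(k-1)q}\sum_{\sigma\in S(k-1,q)}(-1)^\sigma P\big(\mathfrak X_{\sigma(1)},\dots,\mathfrak X_{\sigma(k-1)},x_{k+q}\otimes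 Q(\mathfrak X_{\sigma(k)},\dots,\mathfrak X_{\sigma(k+q-1)},y_{k+q}),\mathfrak X_{k+q+1},\dots,\mathfrak X_{p+q},x\big)$ $+\sum_{\sigma\in S(p,q)}(-1)^{pq}(-1)^\sigma P\big(\mathfrak X_{\sigma(1)},\dots,\mathfrak X_{\sigma(p)},Q(\mathfrak X_{\sigma(p+1)},\dots,\mathfrak X_{\sigma(p+q)},x)\big)$, with $S(i,j)$ the set of $(i,j)$-shuffles and $(-1)^\sigma$ the sign of $\sigma$. Trilinear bracket on $C^*(V,\mathfrak g)$. Let $\mu$ denote $[\cdot,\cdot,\cdot]_{\mathfrak g}$ and let $\mu\boxplus\rho\in C^1(\mathfrak g\oplus V,\mathfrak g\oplus V)$ be $(\mu\boxplus\rho)(x+u,y+v,z+w)=[x,y,z]_{\mathfrak g}+\rho(x,y)w$. Let $C^n(V,\mathfrak g)=\mathrm{Hom}((\otimes^2V)^{\otimes n}\otimes V,\mathfrak g)$ (degree $n$), $C^*(V,\mathfrak g)=\bigoplus_{n\ge0}C^n(V,\mathfrak g)$, regarded as a subspace of $C^*(\mathfrak g\oplus V,\mathfrak g\oplus V)$ by precomposing every argument with the projection $\mathfrak g\oplus V\to V$ and postcomposing with the inclusion of $\mathfrak g$. Put $\{P,Q,R\}=[[[\mu\boxplus\rho,P]_{\mathsf{3Leib}},Q]_{\mathsf{3Leib}},R]_{\mathsf{3Leib}}\in C^{p+q+r+1}(V,\mathfrak g)$. The twisted $L_\infty$-algebra $(C^*(V,\mathfrak g),l_1^T,l_2^T,l_3^T)$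 has operations $l_1^T(P)=\frac12\{T,T,P\}$, $l_2^T(P,Q)=\{T,P,Q\}$, $l_3^T(P,Q,R)=\{P,Q,R\}$, and $l_k^T=0$ for $k\ge4$. A Maurer-Cartan element is an element of degree $0$, i.e. of $C^0(V,\mathfrak g)=\mathrm{Hom}(V,\mathfrak g)$, satisfying the displayed Maurer-Cartan equation. *)

theory Defs
  imports
    "HOL-Analysis.Product_Vector"
    "HOL-Combinatorics.Permutations"
    "HOL-Computational_Algebra.Polynomial"
begin

section \<open>3-Lie algebras, representations, embedding tensors\<close>

locale three_lie_algebra = vector_space scG
  for scG :: "'k::{alg_closed_field, field_char_0} \<Rightarrow> 'g::ab_group_add \<Rightarrow> 'g" +
  fixes br :: "'g \<Rightarrow> 'g \<Rightarrow> 'g \<Rightarrow> 'g"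
  assumes linear_br1: "Vector_Spaces.linear scG scG (\<lambda>x. br x y z)"
    and linear_br2: "Vector_Spaces.linear scG scG (\<lambda>y. br x y z)"
    and linear_br3: "Vector_Spaces.linear scG scG (\<lambda>z. br x y z)"
    and skew12: "br y x z = - br x y z"
    and skew23: "br x z y = - br x y z"
    and fundamental_identity:
      "br x1 x2 (br x3 x4 x5)
        = br (br x1 x2 x3) x4 x5 + br x3 (br x1 x2 x4) x5 + br x3 x4 (br x1 x2 x5)"

text \<open>
  A linear map from the second exterior power of \<open>'g\<close> to \<open>gl('v)\<close> is given as an alternating
  bilinear map with values in linear endomorphisms; \<open>\<rho> x y v\<close> is \<open>\<rho>(x, y)\<close> applied to \<open>v\<close>.
\<close>

locale three_lie_rep =
  three_lie_algebra scG br + V: vector_space scV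
  for scG :: "'k::{alg_closed_field, field_char_0} \<Rightarrow> 'g::ab_group_add \<Rightarrow> 'g"
    and br :: "'g \<Rightarrow> 'g \<Rightarrow> 'g \<Rightarrow> 'g"
    and scV :: "'k \<Rightarrow> 'v::ab_group_add \<Rightarrow> 'v" +
  fixes \<rho> :: "'g \<Rightarrow> 'g \<Rightarrow> 'v \<Rightarrow> 'v"
  assumes linear_rho1: "Vector_Spaces.linear scG scV (\<lambda>x. \<rho> x y v)"
    and linear_rho2: "Vector_Spaces.linear scG scV (\<lambda>y. \<rho> x y v)"
    and linear_rho3: "Vector_Spaces.linear scV scV (\<rho> x y)"
    and rho_alternating: "\<rho> x x v = 0"
    and rho_comp: "\<rho> x1 x2 (\<rho> x3 x4 v)
        = \<rho> (br x1 x2 x3) x4 v + \<rho> x3 (br x1 x2 x4) v + \<rho> x3 x4 (\<rho> x1 x2 v)"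
    and rho_br: "\<rho> x1 (br x2 x3 x4) v
        = \<rho> x3 x4 (\<rho> x1 x2 v) - \<rho> x2 x4 (\<rho> x1 x3 v) + \<rho> x2 x3 (\<rho> x1 x4 v)"

definition embedding_tensor ::
  "('k::{alg_closed_field, field_char_0} \<Rightarrow> 'g::ab_group_add \<Rightarrow> 'g) \<Rightarrow> ('g \<Rightarrow> 'g \<Rightarrow> 'g \<Rightarrow> 'g) \<Rightarrow>
   ('k \<Rightarrow> 'v::ab_group_add \<Rightarrow> 'v) \<Rightarrow> ('g \<Rightarrow> 'g \<Rightarrow> 'v \<Rightarrow> 'v) \<Rightarrow> ('v \<Rightarrow> 'g) \<Rightarrow> bool"
  where "embedding_tensor scG br scV \<rho> T \<longleftrightarrow>
    Vector_Spaces.linear scV scG T \<and>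
    (\<forall>u v w. br (T u) (T v) (T w) = T (\<rho> (T u) (T v) w))"

section \<open>Cochains\<close>

text \<open>
  A linear map out of a tensor power is represented by the corresponding multilinear map, so an
  element of \<open>Hom((\<otimes>\<^sup>2 W)\<^sup>\<otimes>\<^sup>n \<otimes> W, U)\<close> is evaluated on a list of \<open>n\<close> pairs \<open>(x, y)\<close>, each standing
  for the simple tensor \<open>x \<otimes> y\<close>, and a final vector. A function \<open>P\<close> on lists of all lengths
  represents the family of its components: the component of degree \<open>n\<close> is the restriction of \<open>P\<close>
  to lists of length \<open>n\<close>. Homogeneous elements vanish on lists of every other length.
\<close>

type_synonym ('w, 'u) cochain = "('w \<times> 'w) list \<Rightarrow> 'w \<Rightarrow> 'u"

definition hom_cochains ::
  "('k::field \<Rightarrow> 'w::ab_group_add \<Rightarrow> 'w) \<Rightarrow> ('k \<Rightarrow> 'u::ab_group_add \<Rightarrow> 'u) \<Rightarrow> nat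
    \<Rightarrow> ('w, 'u) cochain set"
  where "hom_cochains scW scU n =
    {P. (\<forall>Xs x. length Xs \<noteq> n \<longrightarrow> P Xs x = 0) \<and>
        (\<forall>Xs. length Xs = n \<longrightarrow> Vector_Spaces.linear scW scU (P Xs)) \<and>
        (\<forall>Xs i y x. length Xs = n \<and> i < n \<longrightarrow>
           Vector_Spaces.linear scW scU (\<lambda>a. P (Xs[i := (a, y)]) x) \<and>
           Vector_Spaces.linear scW scU (\<lambda>a. P (Xs[i := (y, a)]) x))}"

text \<open>A linear map regarded as a cochain of degree 0.\<close>

definition cochain0 :: "('w \<Rightarrow> 'u::zero) \<Rightarrow> ('w, 'u) cochain"
  where "cochain0 f Xs x = (if Xs = [] then f x else 0)"

section \<open>The bracket on \<open>C\<^sup>*(W, W)\<close>\<close>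

text \<open>
  All indices start at 0: shuffles permute \<open>{0..<i+j}\<close>, and the summation index \<open>k\<close> below is
  \<open>k - 1\<close> in the usual formula with indices starting at 1.
\<close>

definition shuffles2 :: "nat \<Rightarrow> nat \<Rightarrow> (nat \<Rightarrow> nat) set"
  where "shuffles2 i j = {\<sigma>. \<sigma> permutes {0..<i+j} \<and>
     strict_mono_on {0..<i} \<sigma> \<and> strict_mono_on {i..<i+j} \<sigma>}"

text \<open>\<open>circ scW p q P Q\<close> is \<open>P\<^sub>p \<circ> Q\<^sub>q\<close>, to be evaluated on lists of length \<open>p + q\<close>.\<close>

definition circ ::
  "('k::field \<Rightarrow> 'w::ab_group_add \<Rightarrow> 'w) \<Rightarrow> nat \<Rightarrow> nat \<Rightarrow> ('w, 'w) cochain \<Rightarrow> ('w, 'w) cochain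
    \<Rightarrow> ('w, 'w) cochain"
  where "circ scW p q P Q Xs x =
    (\<Sum>k<p. scW ((-1) ^ (k * q)) (\<Sum>\<sigma>\<in>shuffles2 k q. scW (of_int (sign \<sigma>))
       (P (map (\<lambda>i. Xs ! \<sigma> i) [0..<k]
           @ [(Q (map (\<lambda>i. Xs ! \<sigma> i) [k..<k+q]) (fst (Xs ! (k+q))), snd (Xs ! (k+q)))]
           @ drop (Suc (k+q)) Xs) x)))
   + (\<Sum>k<p. scW ((-1) ^ (k * q)) (\<Sum>\<sigma>\<in>shuffles2 k q. scW (of_int (sign \<sigma>))
       (P (map (\<lambda>i. Xs ! \<sigma> i) [0..<k]
           @ [(fst (Xs ! (k+q)), Q (map (\<lambda>i. Xs ! \<sigma> i) [k..<k+q]) (snd (Xs ! (k+q))))]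
           @ drop (Suc (k+q)) Xs) x)))
   + (\<Sum>\<sigma>\<in>shuffles2 p q. scW ((-1) ^ (p * q)) (scW (of_int (sign \<sigma>))
       (P (map (\<lambda>i. Xs ! \<sigma> i) [0..<p]) (Q (map (\<lambda>i. Xs ! \<sigma> i) [p..<p+q]) x))))"

text \<open>
  The bilinear extension of \<open>[P, Q] = P \<circ> Q - (-1)\<^sup>p\<^sup>q Q \<circ> P\<close> to \<open>C\<^sup>*(W, W)\<close>: the component of degree
  \<open>n\<close> is the sum over all \<open>p + q = n\<close> of the brackets of the components of degrees \<open>p\<close> and \<open>q\<close>.
\<close>

definition leib3_bracket ::
  "('k::field \<Rightarrow> 'w::ab_group_add \<Rightarrow> 'w) \<Rightarrow> ('w, 'w) cochain \<Rightarrow> ('w, 'w) cochain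
    \<Rightarrow> ('w, 'w) cochain"
  where "leib3_bracket scW P Q Xs x =
    (\<Sum>p\<le>length Xs. let q = length Xs - p in
       circ scW p q P Q Xs x - scW ((-1) ^ (p * q)) (circ scW q p Q P Xs x))"

section \<open>The twisted operations on \<open>C\<^sup>*(V, \<gg>)\<close>\<close>

fun boxplus ::
  "('g \<Rightarrow> 'g \<Rightarrow> 'g \<Rightarrow> 'g) \<Rightarrow> ('g \<Rightarrow> 'g \<Rightarrow> 'v \<Rightarrow> 'v)
    \<Rightarrow> ('g::ab_group_add \<times> 'v::ab_group_add, 'g \<times> 'v) cochain"
  where
    "boxplus br \<rho> [((x, u), (y, v))] (z, w) = (br x y z, \<rho> x y w)"
  | "boxplus br \<rho> _ _ = 0"

definition lift_cochain ::
  "('v, 'g) cochain \<Rightarrow> ('g \<times> 'v::ab_group_add, 'g \<times> 'v) cochain"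
  where "lift_cochain P Xs x = (P (map (map_prod snd snd) Xs) (snd x), 0)"

text \<open>
  The iterated bracket of lifted cochains is again a lifted cochain, so it is recovered as an
  element of \<open>C\<^sup>*(V, \<gg>)\<close> by evaluating on \<open>V\<close> and taking the \<open>\<gg>\<close>-component.
\<close>

definition tri_bracket ::
  "('k::field_char_0 \<Rightarrow> 'g::ab_group_add \<Rightarrow> 'g) \<Rightarrow> ('g \<Rightarrow> 'g \<Rightarrow> 'g \<Rightarrow> 'g) \<Rightarrow>
   ('k \<Rightarrow> 'v::ab_group_add \<Rightarrow> 'v) \<Rightarrow> ('g \<Rightarrow> 'g \<Rightarrow> 'v \<Rightarrow> 'v) \<Rightarrow>
   ('v, 'g) cochain \<Rightarrow> ('v, 'g) cochain \<Rightarrow> ('v, 'g) cochain \<Rightarrow> ('v, 'g) cochain"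
  where "tri_bracket scG br scV \<rho> P Q R Xs x =
    (let b = leib3_bracket (module_prod.scale scG scV)
     in fst (b (b (b (boxplus br \<rho>) (lift_cochain P)) (lift_cochain Q)) (lift_cochain R)
          (map (map_prod (Pair 0) (Pair 0)) Xs) (0, x)))"

text \<open>
  \<open>twisted_op \<dots> T [P\<^sub>1, \<dots>, P\<^sub>k]\<close> is \<open>l\<^sub>k\<^sup>T(P\<^sub>1, \<dots>, P\<^sub>k)\<close>. There is no operation with \<open>k = 0\<close>.
\<close>

fun twisted_op ::
  "('k::field_char_0 \<Rightarrow> 'g::ab_group_add \<Rightarrow> 'g) \<Rightarrow> ('g \<Rightarrow> 'g \<Rightarrow> 'g \<Rightarrow> 'g) \<Rightarrow>
   ('k \<Rightarrow> 'v::ab_group_add \<Rightarrow> 'v) \<Rightarrow> ('g \<Rightarrow> 'g \<Rightarrow> 'v \<Rightarrow> 'v) \<Rightarrow>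
   ('v \<Rightarrow> 'g) \<Rightarrow> ('v, 'g) cochain list \<Rightarrow> ('v, 'g) cochain"
  where
    "twisted_op scG br scV \<rho> T [P] =
       (\<lambda>Xs x. scG (1 / 2) (tri_bracket scG br scV \<rho> (cochain0 T) (cochain0 T) P Xs x))"
  | "twisted_op scG br scV \<rho> T [P, Q] = tri_bracket scG br scV \<rho> (cochain0 T) P Q"
  | "twisted_op scG br scV \<rho> T [P, Q, R] = tri_bracket scG br scV \<rho> P Q R"
  | "twisted_op scG br scV \<rho> T _ = (\<lambda>_ _. 0)"

definition maurer_cartan ::
  "('k::field_char_0 \<Rightarrow> 'g::ab_group_add \<Rightarrow> 'g) \<Rightarrow> ('g \<Rightarrow> 'g \<Rightarrow> 'g \<Rightarrow> 'g) \<Rightarrow>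
   ('k \<Rightarrow> 'v::ab_group_add \<Rightarrow> 'v) \<Rightarrow> ('g \<Rightarrow> 'g \<Rightarrow> 'v \<Rightarrow> 'v) \<Rightarrow>
   ('v \<Rightarrow> 'g) \<Rightarrow> ('v, 'g) cochain \<Rightarrow> bool"
  where "maurer_cartan scG br scV \<rho> T \<alpha> \<longleftrightarrow>
    \<alpha> \<in> hom_cochains scV scG 0 \<and>
    (\<forall>Xs x. twisted_op scG br scV \<rho> T [\<alpha>] Xs x
       + scG (1 / 2) (twisted_op scG br scV \<rho> T [\<alpha>, \<alpha>] Xs x)
       + scG (1 / fact 3) (twisted_op scG br scV \<rho> T [\<alpha>, \<alpha>, \<alpha>] Xs x) = 0)"

end

theory Submission
  imports Defs
begin

text \<open>
  For linear maps \<open>f, g, h : V \<rightarrow> \<gg>\<close> put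
  \<open>\<Phi>(f, g, h)(u, v, w) = [f u, g v, h w] - h (\<rho> (f u) (g v) w)\<close>.
  This is additive in each of the three maps, and \<open>S\<close> is an embedding tensor exactly when
  the cubic expression \<open>E(S) = \<Phi>(S, S, S)\<close> vanishes. The theorem is the Taylor expansion
  of \<open>E\<close> around \<open>T\<close>: the trilinear bracket \<open>{f, g, h}\<close> is the sum of \<open>\<Phi>\<close> over the six orders of
  its arguments, that is, the full polarization of \<open>E\<close>. In characteristic \<open>0\<close> the coefficients
  \<open>1/2\<close>, \<open>1/2\<close> and \<open>1/6\<close> of the Maurer-Cartan equation turn these sums into the parts
  of \<open>E(T + T')\<close> of degree 1, 2 and 3 in \<open>T'\<close>. So the left hand side of the equation is
  \<open>E(T + T') - E(T)\<close>, and \<open>E(T) = 0\<close> by assumption.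

  The polarization formula (\<open>tri_bracket_cochain0\<close>) rests on one observation about the
  graded bracket: bracketing a ternary operation, of degree 1, with a linear map \<open>d\<close>, of
  degree 0, measures the failure of \<open>d\<close> to be a derivation of the operation
  (\<open>leib3_bracket_ternary\<close>). Now \<open>\<mu> \<boxplus> \<rho>\<close> is bracketed three times with maps
  \<open>(x, u) \<mapsto> (f u, 0)\<close>. These maps compose to zero pairwise, which kills nearly all of the
  terms of the expansion.
\<close>

section \<open>The bracket of homogeneous cochains\<close>

text \<open>
  This consequence of multilinearity is what makes a composite \<open>P \<circ> Q\<close> vanish when the
  component of \<open>Q\<close> vanishes, and it passes to iterated brackets without any bookkeeping
  about linearity in the separate arguments.
\<close>

definition zero_absorbing :: "('w::zero, 'u::zero) cochain \<Rightarrow> bool"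
  where "zero_absorbing P \<longleftrightarrow>
    (\<forall>Xs x. x = 0 \<or> (\<exists>X\<in>set Xs. fst X = 0 \<or> snd X = 0) \<longrightarrow> P Xs x = 0)"

lemma zero_absorbingD:
  assumes "zero_absorbing P"
  shows "P Xs 0 = 0" and "P (Xs @ (0, b) # Ys) x = 0" and "P (Xs @ (a, 0) # Ys) x = 0"
  using assms unfolding zero_absorbing_def by force+

lemma circ_eq_0_outer:
  assumes "module sc"
    and "\<And>Ys y. length Ys = p \<Longrightarrow> P Ys y = 0"
    and "length Xs = p + q"
  shows "circ sc p q P Q Xs x = 0"
proof -
  interpret module sc by fact
  show ?thesis
    unfolding circ_def using assms(2,3) by (auto intro!: sum.neutral)
qed

lemma circ_eq_0_inner:
  assumes "module sc"
    and "zero_absorbing P"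
    and "\<And>Ys y. length Ys = q \<Longrightarrow> Q Ys y = 0"
  shows "circ sc p q P Q Xs x = 0"
proof -
  interpret module sc by fact
  show ?thesis
    unfolding circ_def using assms(3) by (simp add: zero_absorbingD[OF assms(2)])
qed

text \<open>
  On a list of length \<open>n\<close> the bracket sums over all splittings \<open>n = p' + q'\<close>. If \<open>p' \<noteq> p\<close> or
  \<open>q' \<noteq> q\<close>, then the component of \<open>P\<close> or of \<open>Q\<close> is zero, and this zero is the outer map
  of one of the two composites and the inner map of the other.
\<close>

lemma leib3_bracket_homogeneous:
  assumes sc: "module sc"
    and P: "zero_absorbing P" "\<And>Ys y. length Ys \<noteq> p \<Longrightarrow> P Ys y = 0"
    and Q: "zero_absorbing Q" "\<And>Ys y. length Ys \<noteq> q \<Longrightarrow> Q Ys y = 0"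
  shows "leib3_bracket sc P Q Xs x =
    (if length Xs = p + q
     then circ sc p q P Q Xs x - sc ((-1) ^ (p * q)) (circ sc q p Q P Xs x) else 0)"
proof -
  interpret module sc by fact
  define n where "n = length Xs"
  have "leib3_bracket sc P Q Xs x = (\<Sum>p'\<le>n. if p' = p \<and> n - p' = q
      then circ sc p q P Q Xs x - sc ((-1) ^ (p * q)) (circ sc q p Q P Xs x) else 0)"
    unfolding leib3_bracket_def Let_def n_def[symmetric]
  proof (intro sum.cong refl)
    fix p' assume "p' \<in> {..n}"
    then have len: "length Xs = p' + (n - p')" "length Xs = (n - p') + p'"
      by (auto simp: n_def)
    show "circ sc p' (n - p') P Q Xs x
        - sc ((-1) ^ (p' * (n - p'))) (circ sc (n - p') p' Q P Xs x)
      = (if p' = p \<and> n - p' = q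
         then circ sc p q P Q Xs x - sc ((-1) ^ (p * q)) (circ sc q p Q P Xs x) else 0)"
    proof (cases "p' = p \<and> n - p' = q")
      case False
      then consider "p' \<noteq> p" | "n - p' \<noteq> q" by blast
      then have "circ sc p' (n - p') P Q Xs x = 0 \<and> circ sc (n - p') p' Q P Xs x = 0"
      proof cases
        case 1
        then show ?thesis
          using circ_eq_0_outer[OF sc _ len(1)] circ_eq_0_inner[OF sc Q(1)] P(2) by metis
      next
        case 2
        then show ?thesis
          using circ_eq_0_outer[OF sc _ len(2)] circ_eq_0_inner[OF sc P(1)] Q(2) by metis
      qed
      then show ?thesis using False by auto
    qed auto
  qed
  also have "\<dots> = (if n = p + q
      then circ sc p q P Q Xs x - sc ((-1) ^ (p * q)) (circ sc q p Q P Xs x) else 0)"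
  proof (cases "n = p + q")
    case True
    then have "(p' = p \<and> n - p' = q) = (p' = p)" for p' by auto
    then show ?thesis using True by simp
  qed (auto intro!: sum.neutral)
  finally show ?thesis by (simp add: n_def)
qed

section \<open>Ternary operations and derivations\<close>

definition ternary_cochain :: "('w \<Rightarrow> 'w \<Rightarrow> 'w \<Rightarrow> 'u::zero) \<Rightarrow> ('w, 'u) cochain"
  where "ternary_cochain F Xs x = (case Xs of [(a, b)] \<Rightarrow> F a b x | _ \<Rightarrow> 0)"

lemma ternary_cochain_simps [simp]:
  "ternary_cochain F [(a, b)] x = F a b x"
  "length Xs \<noteq> 1 \<Longrightarrow> ternary_cochain F Xs x = 0"
  by (auto simp: ternary_cochain_def split: list.splits)

definition derivation_defect ::
  "('w \<Rightarrow> 'w) \<Rightarrow> ('w \<Rightarrow> 'w \<Rightarrow> 'w \<Rightarrow> 'w::ab_group_add) \<Rightarrow> 'w \<Rightarrow> 'w \<Rightarrow> 'w \<Rightarrow> 'w"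
  where "derivation_defect d F a b c = F (d a) b c + F a (d b) c + F a b (d c) - d (F a b c)"

lemma zero_absorbing_ternary_cochain:
  "zero_absorbing (ternary_cochain F) \<longleftrightarrow>
     (\<forall>a b. F 0 a b = 0 \<and> F a 0 b = 0 \<and> F a b 0 = 0)"
  (is "?L \<longleftrightarrow> ?R")
proof
  assume ?L
  then have "x = 0 \<or> a = 0 \<or> b = 0 \<longrightarrow> ternary_cochain F [(a, b)] x = 0" for a b x
    unfolding zero_absorbing_def by (elim allE[of _ "[(a, b)]"] allE[of _ x]) auto
  then show ?R by simp
next
  assume ?R
  then show ?L
    by (auto simp: zero_absorbing_def ternary_cochain_def split: list.splits)
qed

lemma zero_absorbing_cochain0: "d 0 = 0 \<Longrightarrow> zero_absorbing (cochain0 d)"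
  by (auto simp: zero_absorbing_def cochain0_def)

lemma zero_absorbing_derivation_defect:
  assumes "zero_absorbing (ternary_cochain F)" and "d 0 = 0"
  shows "zero_absorbing (ternary_cochain (derivation_defect d F))"
  using assms unfolding zero_absorbing_ternary_cochain derivation_defect_def by simp

lemma shuffles2_trivial: "i + j \<le> 1 \<Longrightarrow> shuffles2 i j = {id}"
proof -
  assume ij: "i + j \<le> 1"
  then have "{0..<i + j} \<subseteq> {0}" by auto
  then have "\<sigma> permutes {0..<i + j} \<Longrightarrow> \<sigma> = id" for \<sigma>
    by (meson permutes_subset permutes_sing)
  then show ?thesis using ij
    by (auto simp: shuffles2_def permutes_id strict_mono_on_def)
qed

text \<open>
  In these degrees all shuffles are trivial and all signs are positive: composing with \<open>d\<close>
  inside inserts it into each of the three arguments in turn, composing with it outside applies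
  it to the result.
\<close>

lemma leib3_bracket_ternary:
  assumes sc: "module sc"
    and F: "zero_absorbing (ternary_cochain F)" and d: "d 0 = 0"
  shows "leib3_bracket sc (ternary_cochain F) (cochain0 d)
    = ternary_cochain (derivation_defect d F)"
proof (intro ext)
  fix Xs x
  interpret module sc by fact
  have eq: "leib3_bracket sc (ternary_cochain F) (cochain0 d) Xs x =
    (if length Xs = 1 + 0 then circ sc 1 0 (ternary_cochain F) (cochain0 d) Xs x
       - sc ((-1) ^ (1 * 0)) (circ sc 0 1 (cochain0 d) (ternary_cochain F) Xs x) else 0)"
    by (intro leib3_bracket_homogeneous sc F zero_absorbing_cochain0 d)
       (auto simp: cochain0_def)
  show "leib3_bracket sc (ternary_cochain F) (cochain0 d) Xs x
    = ternary_cochain (derivation_defect d F) Xs x"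
  proof (cases "length Xs = 1")
    case True
    then obtain a b where "Xs = [(a, b)]"
      by (metis One_nat_def length_0_conv length_Suc_conv surj_pair)
    then show ?thesis unfolding eq
      by (simp add: circ_def shuffles2_trivial sign_id cochain0_def derivation_defect_def)
  qed (simp add: eq)
qed

section \<open>The trilinear bracket on linear maps\<close>

lemma boxplus_eq_ternary_cochain:
  "boxplus br \<rho> = ternary_cochain
     (\<lambda>a b c. (br (fst a) (fst b) (fst c), \<rho> (fst a) (fst b) (snd c)))"
proof (intro ext)
  fix Xs x
  show "boxplus br \<rho> Xs x = ternary_cochain
     (\<lambda>a b c. (br (fst a) (fst b) (fst c), \<rho> (fst a) (fst b) (snd c))) Xs x"
    by (cases x) (auto simp: ternary_cochain_def split: list.splits)
qed

lemma lift_cochain_cochain0: "lift_cochain (cochain0 f) = cochain0 (\<lambda>x. (f (snd x), 0))"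
  by (auto simp: lift_cochain_def cochain0_def fun_eq_iff zero_prod_def)

definition embedding_form ::
  "('g \<Rightarrow> 'g \<Rightarrow> 'g \<Rightarrow> 'g) \<Rightarrow> ('g \<Rightarrow> 'g \<Rightarrow> 'v \<Rightarrow> 'v)
    \<Rightarrow> ('v \<Rightarrow> 'g) \<Rightarrow> ('v \<Rightarrow> 'g) \<Rightarrow> ('v \<Rightarrow> 'g) \<Rightarrow> 'v \<Rightarrow> 'v \<Rightarrow> 'v \<Rightarrow> 'g::ab_group_add"
  where "embedding_form br \<rho> f g h u v w = br (f u) (g v) (h w) - h (\<rho> (f u) (g v) w)"

lemma linear_map_zero: "Vector_Spaces.linear s1 s2 f \<Longrightarrow> f 0 = 0"
  and linear_map_add: "Vector_Spaces.linear s1 s2 f \<Longrightarrow> f (x + y) = f x + f y"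
proof -
  assume "Vector_Spaces.linear s1 s2 f"
  then interpret Vector_Spaces.linear s1 s2 f .
  show "f 0 = 0" "f (x + y) = f x + f y" by (rule zero add)+
qed

context three_lie_rep
begin

lemmas br_zero [simp] =
  linear_map_zero[OF linear_br1] linear_map_zero[OF linear_br2] linear_map_zero[OF linear_br3]

lemmas rho_zero [simp] =
  linear_map_zero[OF linear_rho1] linear_map_zero[OF linear_rho2] linear_map_zero[OF linear_rho3]

lemmas br_add =
  linear_map_add[OF linear_br1] linear_map_add[OF linear_br2] linear_map_add[OF linear_br3]

lemmas rho_add =
  linear_map_add[OF linear_rho1] linear_map_add[OF linear_rho2] linear_map_add[OF linear_rho3]

lemma module_prod_scale: "module (module_prod.scale scG scV)"
proof -
  interpret vector_space_prod scG scV by unfold_locales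
  show ?thesis by unfold_locales
qed

text \<open>
  Each inserted map sees only the \<open>V\<close>-component of its argument and produces a vector
  of \<open>\<gg>\<close>. The three brackets insert \<open>f, g, h\<close> into slots of \<open>\<mu> \<boxplus> \<rho>\<close> or apply them to a value. On
  arguments from \<open>V\<close> a term survives only if \<open>\<mu>\<close> receives an inserted map in every slot,
  or if \<open>\<rho>\<close> receives one in each of its first two slots and the third map is applied to the
  resulting vector in \<open>V\<close>.
\<close>

lemma tri_bracket_cochain0:
  assumes f: "Vector_Spaces.linear scV scG f"
    and g: "Vector_Spaces.linear scV scG g"
    and h: "Vector_Spaces.linear scV scG h"
  shows "tri_bracket scG br scV \<rho> (cochain0 f) (cochain0 g) (cochain0 h) =
    ternary_cochain (\<lambda>u v w.
      embedding_form br \<rho> f g h u v w + embedding_form br \<rho> f h g u v w +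
      embedding_form br \<rho> g f h u v w + embedding_form br \<rho> g h f u v w +
      embedding_form br \<rho> h f g u v w + embedding_form br \<rho> h g f u v w)"
proof (intro ext)
  fix Xs :: "('v \<times> 'v) list" and x :: 'v
  define F :: "'g \<times> 'v \<Rightarrow> 'g \<times> 'v \<Rightarrow> 'g \<times> 'v \<Rightarrow> 'g \<times> 'v"
    where "F = (\<lambda>a b c. (br (fst a) (fst b) (fst c), \<rho> (fst a) (fst b) (snd c)))"
  define D :: "('v \<Rightarrow> 'g) \<Rightarrow> 'g \<times> 'v \<Rightarrow> 'g \<times> 'v" where "D f = (\<lambda>x. (f (snd x), 0))" for f
  note zero = linear_map_zero[OF f] linear_map_zero[OF g] linear_map_zero[OF h]
  have D0: "D f 0 = 0" "D g 0 = 0" "D h 0 = 0"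
    by (simp_all add: D_def zero zero_prod_def)
  have F0: "zero_absorbing (ternary_cochain F)"
    by (simp add: zero_absorbing_ternary_cochain F_def zero_prod_def)
  note absorb = zero_absorbing_derivation_defect
  note bracket = leib3_bracket_ternary[OF module_prod_scale]
  have "leib3_bracket (module_prod.scale scG scV) (leib3_bracket (module_prod.scale scG scV)
      (leib3_bracket (module_prod.scale scG scV) (boxplus br \<rho>) (lift_cochain (cochain0 f)))
      (lift_cochain (cochain0 g))) (lift_cochain (cochain0 h))
    = ternary_cochain
        (derivation_defect (D h) (derivation_defect (D g) (derivation_defect (D f) F)))"
    by (simp add: boxplus_eq_ternary_cochain lift_cochain_cochain0 bracket absorb F0 D0
        flip: F_def D_def)
  then have eq: "tri_bracket scG br scV \<rho> (cochain0 f) (cochain0 g) (cochain0 h) Xs x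
    = fst (ternary_cochain
        (derivation_defect (D h) (derivation_defect (D g) (derivation_defect (D f) F)))
        (map (map_prod (Pair 0) (Pair 0)) Xs) (0, x))"
    by (simp add: tri_bracket_def Let_def)
  note add = linear_map_add[OF f] linear_map_add[OF g] linear_map_add[OF h]
  show "tri_bracket scG br scV \<rho> (cochain0 f) (cochain0 g) (cochain0 h) Xs x =
    ternary_cochain (\<lambda>u v w.
      embedding_form br \<rho> f g h u v w + embedding_form br \<rho> f h g u v w +
      embedding_form br \<rho> g f h u v w + embedding_form br \<rho> g h f u v w +
      embedding_form br \<rho> h f g u v w + embedding_form br \<rho> h g f u v w) Xs x"
  proof (cases "length Xs = 1")
    case True
    then obtain u v where Xs: "Xs = [(u, v)]"
      by (metis One_nat_def length_0_conv length_Suc_conv surj_pair)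
    show ?thesis
      unfolding eq unfolding Xs
      by (simp add: derivation_defect_def D_def F_def zero embedding_form_def add)
  qed (simp add: eq)
qed

lemma embedding_form_add:
  assumes "Vector_Spaces.linear scV scG f" and "Vector_Spaces.linear scV scG f'"
  shows "embedding_form br \<rho> (\<lambda>v. f v + f' v) (\<lambda>v. f v + f' v) (\<lambda>v. f v + f' v) u v w =
      embedding_form br \<rho> f f f u v w
    + (embedding_form br \<rho> f f f' u v w + embedding_form br \<rho> f f' f u v w
       + embedding_form br \<rho> f' f f u v w)
    + (embedding_form br \<rho> f f' f' u v w + embedding_form br \<rho> f' f f' u v w
       + embedding_form br \<rho> f' f' f u v w)
    + embedding_form br \<rho> f' f' f' u v w"
  using linear_map_add[OF assms(1)] linear_map_add[OF assms(2)]
  by (simp add: embedding_form_def br_add rho_add)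

lemma embedding_tensor_iff:
  "embedding_tensor scG br scV \<rho> S \<longleftrightarrow>
    Vector_Spaces.linear scV scG S \<and> (\<forall>u v w. embedding_form br \<rho> S S S u v w = 0)"
  by (simp add: embedding_tensor_def embedding_form_def)

lemma scale_inverse_sum:
  "scG (1 / 2) (a + a) = a"
  "scG (1 / fact 3) (a + a + a + a + a + a) = a"
proof -
  have "scG (1 / 2) (a + a) = scG (1 / 2 + 1 / 2) a"
    by (simp only: scale_left_distrib scale_right_distrib)
  then show "scG (1 / 2) (a + a) = a" by simp
  have "(1 / 6 + 1 / 6 + 1 / 6 + 1 / 6 + 1 / 6 + 1 / 6 :: 'k) = 1"
    by simp
  moreover have "scG (1 / 6) (a + a + a + a + a + a)
    = scG (1 / 6 + 1 / 6 + 1 / 6 + 1 / 6 + 1 / 6 + 1 / 6) a"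
    by (simp only: scale_left_distrib scale_right_distrib)
  ultimately show "scG (1 / fact 3) (a + a + a + a + a + a) = a"
    by (simp add: fact_numeral)
qed

text \<open>
  Among the six orders of \<open>T, T, T'\<close>, or of \<open>T, T', T'\<close>, each of the three distinct ones
  occurs twice, and all six orders of \<open>T', T', T'\<close> agree. The factorials in the
  Maurer-Cartan equation cancel these multiplicities, which leaves the terms of positive degree
  in \<open>T'\<close> of the expansion \<open>embedding_form_add\<close>. On lists of length other than 1
  the equation is trivial.
\<close>

lemma maurer_cartan_iff:
  assumes T: "Vector_Spaces.linear scV scG T" and T': "Vector_Spaces.linear scV scG T'"
  shows "maurer_cartan scG br scV \<rho> T (cochain0 T') \<longleftrightarrow>
    (\<forall>u v w. embedding_form br \<rho> (\<lambda>v. T v + T' v) (\<lambda>v. T v + T' v) (\<lambda>v. T v + T' v) u v w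
       = embedding_form br \<rho> T T T u v w)"
proof -
  let ?S = "\<lambda>v. T v + T' v"
  let ?\<Phi> = "embedding_form br \<rho>"
  let ?MC = "\<lambda>Xs x. twisted_op scG br scV \<rho> T [cochain0 T'] Xs x
       + scG (1 / 2) (twisted_op scG br scV \<rho> T [cochain0 T', cochain0 T'] Xs x)
       + scG (1 / fact 3) (twisted_op scG br scV \<rho> T [cochain0 T', cochain0 T', cochain0 T'] Xs x)"
  note tri = tri_bracket_cochain0[OF T T T'] tri_bracket_cochain0[OF T T' T']
    tri_bracket_cochain0[OF T' T' T']
  have hom: "cochain0 T' \<in> hom_cochains scV scG 0"
    using T' by (auto simp: hom_cochains_def cochain0_def[abs_def])
  have MC1: "?MC [(u, v)] w = ?\<Phi> ?S ?S ?S u v w - ?\<Phi> T T T u v w" for u v w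
  proof -
    define a where "a = ?\<Phi> T T T' u v w + ?\<Phi> T T' T u v w + ?\<Phi> T' T T u v w"
    define b where "b = ?\<Phi> T T' T' u v w + ?\<Phi> T' T T' u v w + ?\<Phi> T' T' T u v w"
    define c where "c = ?\<Phi> T' T' T' u v w"
    have "tri_bracket scG br scV \<rho> (cochain0 T) (cochain0 T) (cochain0 T') [(u, v)] w = a + a"
      and "tri_bracket scG br scV \<rho> (cochain0 T) (cochain0 T') (cochain0 T') [(u, v)] w = b + b"
      and "tri_bracket scG br scV \<rho> (cochain0 T') (cochain0 T') (cochain0 T') [(u, v)] w
        = c + c + c + c + c + c"
      by (simp_all add: tri a_def b_def c_def algebra_simps)
    then have "?MC [(u, v)] w = a + b + c"
      by (simp only: twisted_op.simps scale_inverse_sum)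
    then show ?thesis
      by (simp add: embedding_form_add[OF T T'] a_def b_def c_def)
  qed
  have MC0: "?MC Xs x = 0" if "length Xs \<noteq> 1" for Xs x
    using that by (simp add: tri)
  have "(\<forall>Xs x. ?MC Xs x = 0) \<longleftrightarrow> (\<forall>u v w. ?MC [(u, v)] w = 0)" (is "?L \<longleftrightarrow> ?R")
  proof
    assume R: ?R
    show ?L
    proof (intro allI)
      fix Xs x
      show "?MC Xs x = 0"
      proof (cases "length Xs = 1")
        case True
        then obtain u v where "Xs = [(u, v)]"
          by (metis One_nat_def length_0_conv length_Suc_conv surj_pair)
        then show ?thesis by (simp only: R)
      qed (rule MC0)
    qed
  qed (intro allI, erule allE, erule allE)
  then show ?thesis
    unfolding maurer_cartan_def MC1 using hom by simp
qed

end

theorem theorem3p13: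
  fixes scG :: "'k::{alg_closed_field, field_char_0} \<Rightarrow> 'g::ab_group_add \<Rightarrow> 'g"
    and br :: "'g \<Rightarrow> 'g \<Rightarrow> 'g \<Rightarrow> 'g"
    and scV :: "'k \<Rightarrow> 'v::ab_group_add \<Rightarrow> 'v"
    and \<rho> :: "'g \<Rightarrow> 'g \<Rightarrow> 'v \<Rightarrow> 'v"
    and T T' :: "'v \<Rightarrow> 'g"
  assumes "three_lie_algebra scG br"
    and "three_lie_rep scG br scV \<rho>"
    and "embedding_tensor scG br scV \<rho> T"
    and "Vector_Spaces.linear scV scG T'"
  shows "embedding_tensor scG br scV \<rho> (\<lambda>v. T v + T' v) \<longleftrightarrow>
         maurer_cartan scG br scV \<rho> T (cochain0 T')"
proof -
  interpret three_lie_rep scG br scV \<rho> by fact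
  interpret vector_space_pair scV scG by unfold_locales
  have "Vector_Spaces.linear scV scG T" and "\<And>u v w. embedding_form br \<rho> T T T u v w = 0"
    using assms(3) by (simp_all add: embedding_tensor_iff)
  then show ?thesis
    using assms(4) by (simp add: embedding_tensor_iff maurer_cartan_iff linear_compose_add)
qed

end
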